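(* Let $\alpha\ge0$ and $f\in\mathcal{W}^0_{\mathcal{H}}(\alpha)$. Then for each integer $q\ge2$, $s_{1,q}(f)\in\mathcal{W}^0_{\mathcal{H}}(\alpha)$ for $|z|<1/2$.
   Context: $\mathbb{D}=\{z\in\mathbb{C}:|z|<1\}$. $\mathcal{H}$ is the class of complex-valued harmonic functions $f$ in $\mathbb{D}$ with $f(0)=0$ and $f_z(0)=1$; each has the canonical representation $f=h+\overline{g}$ with $h(z)=z+\sum_{n\ge2}a_nz^n$ and $g(z)=\sum_{n\ge1}b_nz^n$ analytic in $\mathbb{D}$. For $\alpha\ge0$, $\mathcal{W}^0_{\mathcal{H}}(\alpha)$ is the class of $f=h+\overline{g}\in\mathcal{H}$ with $g'(0)=0$ (so $b_1=0$) and $\mathrm{Re}(h'(z)+\alpha zh''(z))>|g'(z)+\alpha zg''(z)|$ for all $z\in\mathbb{D}$. For $p,q\ge1$ the $(p,q)$-th partial sum of $f=h+\overline{g}$ is $s_{p,q}(f)=s_p(h)+\overline{s_q(g)}$, where $s_p(h)(z)=\sum_{k=1}^pa_kz^k$ (with $a_1=1$) and $s_q(g)(z)=\sum_{k=1}^qb_kz^k$. The phrase "$s_{p,q}(f)\in\mathcal{W}^0_{\mathcal{H}}(\alpha)$ for (in) $|z|<r$" means that $\mathrm{Re}(s_p(h)'(z)+\alpha zs_p(h)''(z))>|s_q(g)'(z)+\alpha zs_q(g)''(z)|$ for all $|z|<r$. *)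

theory Defs
  imports "HOL-Analysis.Analysis"
begin

definition partial_x :: "(complex \<Rightarrow> complex) \<Rightarrow> complex \<Rightarrow> complex" where
  "partial_x f z = frechet_derivative f (at z) 1"

definition partial_y :: "(complex \<Rightarrow> complex) \<Rightarrow> complex \<Rightarrow> complex" where
  "partial_y f z = frechet_derivative f (at z) \<i>"

definition wirtinger_z :: "(complex \<Rightarrow> complex) \<Rightarrow> complex \<Rightarrow> complex" where
  "wirtinger_z f z = (partial_x f z - \<i> * partial_y f z) / 2"

text \<open>Differentiability is real (Frechet) differentiability; it is required explicitly, since
  \<^const>\<open>frechet_derivative\<close> is unspecified where the derivative does not exist. The set is
  meant to be open.\<close>

definition harmonic_on :: "(complex \<Rightarrow> complex) \<Rightarrow> complex set \<Rightarrow> bool" where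
  "harmonic_on f S \<longleftrightarrow>
     (\<forall>z\<in>S. f differentiable (at z) \<and> partial_x f differentiable (at z)
            \<and> partial_y f differentiable (at z)) \<and>
     continuous_on S (partial_x (partial_x f)) \<and>
     continuous_on S (partial_y (partial_x f)) \<and>
     continuous_on S (partial_x (partial_y f)) \<and>
     continuous_on S (partial_y (partial_y f)) \<and>
     (\<forall>z\<in>S. partial_x (partial_x f) z + partial_y (partial_y f) z = 0)"

definition class_H :: "(complex \<Rightarrow> complex) set" where
  "class_H = {f. harmonic_on f (ball 0 1) \<and> f 0 = 0 \<and> wirtinger_z f 0 = 1}"

text \<open>The canonical representation \<open>f = h + cnj g\<close> on the unit disc. For \<open>f\<close> in
  \<^const>\<open>class_H\<close> the power series of \<open>h\<close> starts with \<open>z\<close>, because \<open>h' 0\<close> is the value of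
  \<open>f\<^sub>z\<close> at 0. On the disc, \<open>h\<close> and \<open>g\<close> are uniquely determined by \<open>f\<close>.\<close>

definition canonical_rep ::
  "(complex \<Rightarrow> complex) \<Rightarrow> (complex \<Rightarrow> complex) \<Rightarrow> (complex \<Rightarrow> complex) \<Rightarrow> bool" where
  "canonical_rep f h g \<longleftrightarrow>
     h holomorphic_on ball 0 1 \<and> g holomorphic_on ball 0 1 \<and> h 0 = 0 \<and> g 0 = 0 \<and>
     (\<forall>z\<in>ball 0 1. f z = h z + cnj (g z))"

definition W_condition ::
  "real \<Rightarrow> (complex \<Rightarrow> complex) \<Rightarrow> (complex \<Rightarrow> complex) \<Rightarrow> real \<Rightarrow> bool" where
  "W_condition \<alpha> h g r \<longleftrightarrow>
     (\<forall>z. cmod z < r \<longrightarrow>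
        Re (deriv h z + of_real \<alpha> * z * deriv (deriv h) z)
          > cmod (deriv g z + of_real \<alpha> * z * deriv (deriv g) z))"

definition class_W0 :: "real \<Rightarrow> (complex \<Rightarrow> complex) set" where
  "class_W0 \<alpha> = {f \<in> class_H. \<exists>h g. canonical_rep f h g \<and> deriv g 0 = 0 \<and> W_condition \<alpha> h g 1}"

definition taylor_coeff :: "(complex \<Rightarrow> complex) \<Rightarrow> nat \<Rightarrow> complex" where
  "taylor_coeff h k = (deriv ^^ k) h 0 / fact k"

definition partial_sum :: "nat \<Rightarrow> (complex \<Rightarrow> complex) \<Rightarrow> complex \<Rightarrow> complex" where
  "partial_sum p h z = (\<Sum>k=1..p. taylor_coeff h k * z ^ k)"

text \<open>The assertion that the \<open>(p,q)\<close>-th partial sum \<open>partial_sum p h + cnj (partial_sum q g)\<close> of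
  \<open>f = h + cnj g\<close> belongs to the class for \<open>|z| < r\<close>; it is expressed through the analytic and
  co-analytic parts.\<close>

definition partial_sum_in_W0 ::
  "real \<Rightarrow> nat \<Rightarrow> nat \<Rightarrow> (complex \<Rightarrow> complex) \<Rightarrow> (complex \<Rightarrow> complex) \<Rightarrow> real \<Rightarrow> bool" where
  "partial_sum_in_W0 \<alpha> p q h g r \<longleftrightarrow> W_condition \<alpha> (partial_sum p h) (partial_sum q g) r"

end

theory Submission
  imports Defs "HOL-Complex_Analysis.Complex_Analysis"
begin

text \<open>Put \<open>P = h' + \<alpha> z h''\<close> and \<open>Q = g' + \<alpha> z g''\<close>, so that \<open>\<bar>Q\<bar> < Re P\<close> on the disc,
  \<open>P(0) = 1\<close> and \<open>Q(0) = 0\<close>. By the mean value property of \<open>Re P\<close>, integrating over the circle of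
  radius \<open>r\<close> bounds the \<open>n\<close>-th Taylor coefficient of \<open>Q\<close> by \<open>Re P(0) / r\<^sup>n\<close>, hence by 1 as \<open>r \<rightarrow> 1\<close>.
  Passing from \<open>g\<close> to its \<open>q\<close>-th partial sum truncates the power series of \<open>Q\<close> after degree
  \<open>q - 1\<close>, and for \<open>\<bar>z\<bar> < 1/2\<close> the truncation is at most \<open>1/2 + \<dots> + 1/2\<^bsup>q-1\<^esup> < 1\<close>.\<close>

lemma canonical_rep_has_derivative:
  assumes "canonical_rep f h g" "z \<in> ball 0 1"
  shows "(f has_derivative (\<lambda>w. deriv h z * w + cnj (deriv g z * w))) (at z)"
proof -
  have h: "(h has_derivative (*) (deriv h z)) (at z)"
    and g: "(g has_derivative (*) (deriv g z)) (at z)"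
    using assms holomorphic_derivI[of _ "ball 0 1" z]
    by (auto simp: canonical_rep_def has_field_derivative_def)
  have "((\<lambda>w. h w + cnj (g w)) has_derivative (\<lambda>w. deriv h z * w + cnj (deriv g z * w))) (at z)"
    by (rule has_derivative_add[OF h has_derivative_cnj[OF g]])
  then show ?thesis
    by (rule has_derivative_transform_within_open[OF _ open_ball[of 0 1]])
      (use assms in \<open>auto simp: canonical_rep_def\<close>)
qed

text \<open>Comparing the real derivative of \<open>f\<close> in the directions 1 and
  \<open>\<i>\<close> separates the two parts: \<open>h'\<close> is \<open>f_z\<close>, and
  \<open>g'\<close> is the conjugate of the other Wirtinger derivative. The right-hand sides involve
  \<open>f\<close> alone, so all representations of \<open>f\<close> share these
  derivatives.\<close>

lemma canonical_rep_deriv: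
  assumes "canonical_rep f h g" "z \<in> ball 0 1"
  shows "deriv h z = wirtinger_z f z"
    and "deriv g z = cnj ((partial_x f z + \<i> * partial_y f z) / 2)"
proof -
  have "frechet_derivative f (at z) = (\<lambda>w. deriv h z * w + cnj (deriv g z * w))"
    using frechet_derivative_at[OF canonical_rep_has_derivative[OF assms]] by simp
  then have *: "partial_x f z = deriv h z + cnj (deriv g z)"
    "partial_y f z = \<i> * deriv h z - \<i> * cnj (deriv g z)"
    by (simp_all add: partial_x_def partial_y_def algebra_simps)
  show "deriv h z = wirtinger_z f z"
    unfolding wirtinger_z_def * by (simp add: algebra_simps)
  show "deriv g z = cnj ((partial_x f z + \<i> * partial_y f z) / 2)"
    unfolding * by (simp add: algebra_simps)
qed

text \<open>Membership in \<open>class_W0\<close> only provides some representation; this carries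
  its inequality over to the given one. First derivatives agree on the whole open disc, hence so do
  second derivatives.\<close>

lemma W_condition_canonical_rep:
  assumes "canonical_rep f h g" "canonical_rep f h' g'" "W_condition \<alpha> h g 1"
  shows "W_condition \<alpha> h' g' 1"
proof -
  have eq: "deriv h' z = deriv h z" "deriv g' z = deriv g z" if "z \<in> ball 0 1" for z
    using canonical_rep_deriv[OF assms(1) that] canonical_rep_deriv[OF assms(2) that]
    by (simp_all only:)
  have "deriv (deriv h') z = deriv (deriv h) z" "deriv (deriv g') z = deriv (deriv g) z"
    if "z \<in> ball 0 1" for z
    by (rule deriv_cong_ev[OF eventually_mono[OF eventually_nhds_in_open[OF open_ball that]] refl],
        rule eq, assumption)+
  with eq assms(3) show ?thesis
    by (auto simp: W_condition_def)
qed

text \<open>Cauchy's formula for the \<open>n\<close>-th derivative at the centre, written as an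
  average over the circle.\<close>

lemma taylor_coeff_has_integral:
  assumes "F holomorphic_on ball 0 1" "0 < r" "r < 1"
  shows "((\<lambda>t. F (circlepath 0 r t) / circlepath 0 r t ^ n) has_integral taylor_coeff F n) {0..1}"
proof -
  have sub: "cball 0 r \<subseteq> ball (0::complex) 1" "ball 0 r \<subseteq> ball (0::complex) 1"
    using assms(3) by auto
  have "((\<lambda>u. F u / (u - 0) ^ Suc n) has_contour_integral
      (2 * pi * \<i> / fact n * (deriv ^^ n) F 0)) (circlepath 0 r)"
    using assms sub
    by (intro Cauchy_has_contour_integral_higher_derivative_circlepath)
      (auto intro: holomorphic_on_subset holomorphic_on_imp_continuous_on)
  then have "((\<lambda>t. F (circlepath 0 r t) / circlepath 0 r t ^ Suc n *
      vector_derivative (circlepath 0 r) (at t within {0..1})) has_integral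
      ((2 * pi * \<i>) * taylor_coeff F n)) {0..1}"
    by (simp add: has_contour_integral_def taylor_coeff_def)
  then have "((\<lambda>t. (2 * pi * \<i>) * (F (circlepath 0 r t) / circlepath 0 r t ^ n)) has_integral
      ((2 * pi * \<i>) * taylor_coeff F n)) {0..1}"
  proof (rule has_integral_cong[THEN iffD1, rotated])
    fix t :: real assume "t \<in> {0..1}"
    \<comment> \<open>The circle \<open>r * exp (2 * pi * \<i> * t)\<close> has velocity
      \<open>2 * pi * \<i>\<close> times itself, which cancels one power in the denominator.\<close>
    then have "vector_derivative (circlepath 0 r) (at t within {0..1}) =
        2 * pi * \<i> * circlepath 0 r t"
      by (simp add: vector_derivative_circlepath01) (simp add: circlepath)
    moreover have "circlepath 0 r t \<noteq> 0"
      using assms(2) by (simp add: circlepath)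
    ultimately show "F (circlepath 0 r t) / circlepath 0 r t ^ Suc n *
        vector_derivative (circlepath 0 r) (at t within {0..1}) =
        (2 * pi * \<i>) * (F (circlepath 0 r t) / circlepath 0 r t ^ n)"
      by simp
  qed
  then show ?thesis
    by (drule_tac has_integral_mult_right[where c = "inverse (2 * pi * \<i>)"])
      (simp add: field_simps)
qed

lemma taylor_coeff_le_Re_value:
  assumes P: "P holomorphic_on ball 0 1" and Q: "Q holomorphic_on ball 0 1"
    and le: "\<And>z. cmod z < 1 \<Longrightarrow> cmod (Q z) \<le> Re (P z)"
  shows "cmod (taylor_coeff Q n) \<le> Re (P 0)"
proof -
  have bound: "cmod (taylor_coeff Q n) * r ^ n \<le> Re (P 0)" if r: "0 < r" "r < 1" for r
  proof -
    note iQ = taylor_coeff_has_integral[OF Q r, of n]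
    \<comment> \<open>The mean value property is the case \<open>n = 0\<close> of the coefficient
      formula.\<close>
    have "((\<lambda>t. P (circlepath 0 r t)) has_integral P 0) {0..1}"
      using taylor_coeff_has_integral[OF P r, of 0] by (simp add: taylor_coeff_def)
    then have iP: "((\<lambda>t. Re (P (circlepath 0 r t)) / r ^ n) has_integral Re (P 0) / r ^ n) {0..1}"
      by (intro has_integral_divide has_integral_Re)
    have "cmod (integral {0..1} (\<lambda>t. Q (circlepath 0 r t) / circlepath 0 r t ^ n))
        \<le> integral {0..1} (\<lambda>t. Re (P (circlepath 0 r t)) / r ^ n)"
    proof (rule integral_norm_bound_integral)
      fix t :: real
      have "cmod (circlepath 0 r t) = r"
        using r by (simp add: circlepath norm_mult)
      with r show "cmod (Q (circlepath 0 r t) / circlepath 0 r t ^ n)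
          \<le> Re (P (circlepath 0 r t)) / r ^ n"
        by (simp add: norm_divide norm_power divide_right_mono le)
    qed (use iP iQ in blast)+
    then have "cmod (taylor_coeff Q n) \<le> Re (P 0) / r ^ n"
      by (simp only: integral_unique[OF iP] integral_unique[OF iQ])
    with r show ?thesis by (simp add: field_simps)
  qed
  have "((\<lambda>r. cmod (taylor_coeff Q n) * r ^ n) \<longlongrightarrow> cmod (taylor_coeff Q n) * 1 ^ n) (at_left 1)"
    by (intro tendsto_intros)
  then show ?thesis
    using bound eventually_at_left_real[of 0 "1::real"]
    by (intro tendsto_upperbound) (auto elim!: eventually_mono)
qed

text \<open>The operator \<open>g' + a z g''\<close> acts on each monomial separately, sending
  \<open>z^(n+1)\<close> to a multiple of \<open>z^n\<close>; this is why it is compatible with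
  truncation.\<close>

lemma taylor_coeff_deriv_plus:
  assumes "g holomorphic_on ball 0 1"
  shows "taylor_coeff (\<lambda>z. deriv g z + a * z * deriv (deriv g) z) n =
    of_nat (Suc n) * (1 + a * of_nat n) * taylor_coeff g (Suc n)"
proof -
  have hol: "deriv g holomorphic_on ball 0 1" "deriv (deriv g) holomorphic_on ball 0 1"
    using assms by (auto intro!: holomorphic_deriv)
  have shift: "(deriv ^^ k) (deriv G) = (deriv ^^ Suc k) G" for k and G :: "complex \<Rightarrow> complex"
    by (simp add: funpow_Suc_right del: funpow.simps)
  have prod: "(deriv ^^ n) (\<lambda>z. z * deriv (deriv g) z) 0 = of_nat n * (deriv ^^ Suc n) g 0"
  proof (cases n)
    case (Suc m)
    have "(deriv ^^ n) (\<lambda>z. z * deriv (deriv g) z) 0 = (\<Sum>i = 0..n. of_nat (n choose i) *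
        (deriv ^^ i) (\<lambda>z. z) 0 * (deriv ^^ (n - i)) (deriv (deriv g)) 0)"
      using hol by (intro higher_deriv_mult[where S = "ball 0 1"]) (auto intro: holomorphic_intros)
    \<comment> \<open>In the Leibniz sum at 0 only \<open>i = 1\<close> survives, since every other
      derivative of the identity vanishes there.\<close>
    also have "\<dots> = (\<Sum>i\<in>{1}. of_nat (n choose i) *
        (deriv ^^ i) (\<lambda>z. z) 0 * (deriv ^^ (n - i)) (deriv (deriv g)) 0)"
      by (rule sum.mono_neutral_right) (auto simp: Suc)
    also have "\<dots> = of_nat n * (deriv ^^ Suc n) g 0"
      by (simp add: Suc shift del: funpow.simps)
    finally show ?thesis .
  qed simp
  have "(deriv ^^ n) (\<lambda>z. deriv g z + a * (z * deriv (deriv g) z)) 0 =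
      (deriv ^^ n) (deriv g) 0 + (deriv ^^ n) (\<lambda>z. a * (z * deriv (deriv g) z)) 0"
    using hol by (intro higher_deriv_add[where S = "ball 0 1"]) (auto intro!: holomorphic_intros)
  also have "(deriv ^^ n) (\<lambda>z. a * (z * deriv (deriv g) z)) 0 =
      a * (deriv ^^ n) (\<lambda>z. z * deriv (deriv g) z) 0"
    using hol by (intro higher_deriv_cmult[where A = "ball 0 1"]) (auto intro!: holomorphic_intros)
  finally have "(deriv ^^ n) (\<lambda>z. deriv g z + a * z * deriv (deriv g) z) 0 =
      (1 + a * of_nat n) * (deriv ^^ Suc n) g 0"
    by (simp only: prod shift) (simp add: algebra_simps)
  then show ?thesis
    by (simp add: taylor_coeff_def divide_simps del: funpow.simps of_nat_Suc)
qed

lemma deriv_partial_sum: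
  "deriv (partial_sum q g) z = (\<Sum>k=1..q. taylor_coeff g k * (of_nat k * z ^ (k - 1)))"
  unfolding partial_sum_def
  by (rule DERIV_imp_deriv) (auto intro!: derivative_eq_intros sum.cong)

lemma deriv_deriv_partial_sum:
  "deriv (deriv (partial_sum q g)) z =
    (\<Sum>k=1..q. taylor_coeff g k * (of_nat k * (of_nat (k - 1) * z ^ (k - 2))))"
  unfolding deriv_partial_sum[abs_def]
  by (rule DERIV_imp_deriv) (auto intro!: derivative_eq_intros sum.cong simp: numeral_2_eq_2)

lemma deriv_plus_partial_sum:
  assumes "g holomorphic_on ball 0 1"
  shows "deriv (partial_sum q g) z + a * z * deriv (deriv (partial_sum q g)) z =
    (\<Sum>n<q. taylor_coeff (\<lambda>z. deriv g z + a * z * deriv (deriv g) z) n * z ^ n)"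
proof -
  have "deriv (partial_sum q g) z + a * z * deriv (deriv (partial_sum q g)) z =
    (\<Sum>k=1..q. of_nat k * (1 + a * of_nat (k - 1)) * taylor_coeff g k * z ^ (k - 1))"
    unfolding deriv_partial_sum deriv_deriv_partial_sum sum_distrib_left sum.distrib[symmetric]
  proof (rule sum.cong)
    fix k assume "k \<in> {1..q}"
    \<comment> \<open>For \<open>k = 1\<close> the exponent \<open>k - 2\<close> is cut off at 0,
      but the factor \<open>k - 1\<close> kills the term; for larger \<open>k\<close> the extra
      \<open>z\<close> raises \<open>z^(k-2)\<close> to \<open>z^(k-1)\<close>.\<close>
    then consider "k = 1" | m where "k = Suc (Suc m)"
      by (metis One_nat_def atLeastAtMost_iff not0_implies_Suc not_one_le_zero)
    then show "taylor_coeff g k * (of_nat k * z ^ (k - 1)) +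
        a * z * (taylor_coeff g k * (of_nat k * (of_nat (k - 1) * z ^ (k - 2)))) =
        of_nat k * (1 + a * of_nat (k - 1)) * taylor_coeff g k * z ^ (k - 1)"
      by cases (simp_all add: algebra_simps)
  qed simp
  also have "\<dots> = (\<Sum>n<q. of_nat (Suc n) * (1 + a * of_nat n) * taylor_coeff g (Suc n) * z ^ n)"
    by (rule sum.reindex_bij_witness[of _ Suc "\<lambda>k. k - 1"]) auto
  finally show ?thesis
    by (simp only: taylor_coeff_deriv_plus[OF assms])
qed

theorem theorem4p3:
  fixes \<alpha> :: real and f h g :: "complex \<Rightarrow> complex" and q :: nat
  assumes "\<alpha> \<ge> 0"
    and "f \<in> class_W0 \<alpha>"
    and "canonical_rep f h g"
    and "q \<ge> 2"
  shows "partial_sum_in_W0 \<alpha> 1 q h g (1/2)"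
proof -
  define P where "P = (\<lambda>z. deriv h z + of_real \<alpha> * z * deriv (deriv h) z)"
  define Q where "Q = (\<lambda>z. deriv g z + of_real \<alpha> * z * deriv (deriv g) z)"
  obtain h0 g0 where h0g0: "canonical_rep f h0 g0" "deriv g0 0 = 0" "W_condition \<alpha> h0 g0 1"
    and f: "f \<in> class_H"
    using assms(2) by (auto simp: class_W0_def)
  have W: "W_condition \<alpha> h g 1"
    using W_condition_canonical_rep[OF h0g0(1) assms(3) h0g0(3)] .
  have h1: "deriv h 0 = 1"
    using f canonical_rep_deriv(1)[OF assms(3), of 0] by (simp add: class_H_def)
  \<comment> \<open>The normalization is known for \<open>g0\<close> only; both derivatives at 0
    equal the same expression in \<open>f\<close>.\<close>
  have g1: "deriv g 0 = 0"
    using h0g0(2) canonical_rep_deriv(2)[OF assms(3), of 0] canonical_rep_deriv(2)[OF h0g0(1), of 0]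
    by simp
  have hol: "h holomorphic_on ball 0 1" "g holomorphic_on ball 0 1"
    using assms(3) by (auto simp: canonical_rep_def)
  have holPQ: "P holomorphic_on ball 0 1" "Q holomorphic_on ball 0 1"
    unfolding P_def Q_def using hol by (auto intro!: holomorphic_intros holomorphic_deriv)
  have coeff: "cmod (taylor_coeff Q n) \<le> 1" for n
    using taylor_coeff_le_Re_value[OF holPQ, of n] W h1
    by (force simp: W_condition_def P_def Q_def)
  have Q0: "taylor_coeff Q 0 = 0"
    by (simp add: taylor_coeff_def Q_def g1)
  obtain m where m: "q = Suc m"
    using assms(4) by (cases q) auto
  show ?thesis
    unfolding partial_sum_in_W0_def W_condition_def
  proof (intro allI impI)
    fix z :: complex assume z: "cmod z < 1/2"
    \<comment> \<open>Dropping the zero constant term makes the dominating geometric series start at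
      1/2, so that it stays below 1 for \<open>cmod z < 1/2\<close>.\<close>
    have "cmod (\<Sum>n<q. taylor_coeff Q n * z ^ n) = cmod (\<Sum>n<m. taylor_coeff Q (Suc n) * z ^ Suc n)"
      by (simp only: m sum.lessThan_Suc_shift Q0) simp
    also have "\<dots> \<le> (\<Sum>n<m. 1 * (1/2) ^ Suc n)"
      by (intro sum_norm_le, unfold norm_mult norm_power, intro mult_mono power_mono)
        (use coeff z in auto)
    also have "\<dots> = 1 - (1/2) ^ m"
      by (induction m) auto
    also have "\<dots> < 1" by simp
    finally have "cmod (\<Sum>n<q. taylor_coeff Q n * z ^ n) < 1" .
    \<comment> \<open>Since \<open>h'(0) = 1\<close>, the first partial sum of \<open>h\<close> is
      \<open>z\<close> itself, so the truncation of \<open>Q\<close> has to be compared with exactly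
      1.\<close>
    moreover have "deriv (partial_sum 1 h) z + of_real \<alpha> * z * deriv (deriv (partial_sum 1 h)) z = 1"
      unfolding deriv_partial_sum deriv_deriv_partial_sum by (simp add: taylor_coeff_def h1)
    ultimately show "Re (deriv (partial_sum 1 h) z + of_real \<alpha> * z * deriv (deriv (partial_sum 1 h)) z) >
        cmod (deriv (partial_sum q g) z + of_real \<alpha> * z * deriv (deriv (partial_sum q g)) z)"
      by (simp add: deriv_plus_partial_sum[OF hol(2)] Q_def)
  qed
qed

end
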